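(* Let $X=(X_t)_{t\in[0,T]}$ be a square-integrable process on $(\Omega,\mathcal{F},P)$, let $\mathcal{H}_X$ be a real separable Hilbert space of (equivalence classes of) processes $u=(u_t)_{t\in[0,T]}$, and let $\delta_X\colon\mathcal{H}_X\to L^2(\Omega)$ be the linear stochastic integral operator with respect to $X$. If $\delta_X$ is continuous, then for each $F\in L^2(\Omega)$ there exists a unique $D_XF\in\mathcal{H}_X$ satisfying $$\mathbb{E}[F\cdot\delta_X(u)]=\langle D_XF,u\rangle_{\mathcal{H}_X}\qquad\text{for all }u\in\mathcal{H}_X .$$
   Context: $(\Omega,\mathcal{F},P)$ is a complete probability space and $L^2(\Omega)$ is the real Hilbert space of square-integrable random variables. The space $\mathcal{H}_X$ is called an energy space for $X$; abstractly it is a real separable Hilbert space equipped with the linear map $\delta_X$ into $L^2(\Omega)$. The element $D_XF$ is called the operator--covariant derivative of $F$. *)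

theory Defs
  imports "HOL-Probability.Probability"
begin

text \<open>
  Elements of \<open>L\<^sup>2(\<Omega>)\<close> are represented by square-integrable functions, and equality of elements is
  equality almost everywhere.
\<close>

definition square_integrable :: "'a measure \<Rightarrow> ('a \<Rightarrow> real) \<Rightarrow> bool" where
  "square_integrable M f \<longleftrightarrow> f \<in> borel_measurable M \<and> integrable M (\<lambda>\<omega>. (f \<omega>)\<^sup>2)"

definition L2_norm :: "'a measure \<Rightarrow> ('a \<Rightarrow> real) \<Rightarrow> real" where
  "L2_norm M f = sqrt (\<integral>\<omega>. (f \<omega>)\<^sup>2 \<partial>M)"

definition square_integrable_process :: "'a measure \<Rightarrow> real \<Rightarrow> (real \<Rightarrow> 'a \<Rightarrow> real) \<Rightarrow> bool" where
  "square_integrable_process M T X \<longleftrightarrow> (\<forall>t\<in>{0..T}. square_integrable M (X t))"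

definition L2_linear :: "'a measure \<Rightarrow> ('h::real_vector \<Rightarrow> 'a \<Rightarrow> real) \<Rightarrow> bool" where
  "L2_linear M \<delta> \<longleftrightarrow>
     (\<forall>u. square_integrable M (\<delta> u)) \<and>
     (\<forall>u v. AE \<omega> in M. \<delta> (u + v) \<omega> = \<delta> u \<omega> + \<delta> v \<omega>) \<and>
     (\<forall>c u. AE \<omega> in M. \<delta> (c *\<^sub>R u) \<omega> = c * \<delta> u \<omega>)"

definition L2_continuous :: "'a measure \<Rightarrow> ('h::topological_space \<Rightarrow> 'a \<Rightarrow> real) \<Rightarrow> bool" where
  "L2_continuous M \<delta> \<longleftrightarrow>
     (\<forall>u. ((\<lambda>v. L2_norm M (\<lambda>\<omega>. \<delta> v \<omega> - \<delta> u \<omega>)) \<longlongrightarrow> 0) (at u))"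

text \<open>
  The vector space \<open>'h\<close> consists of equivalence classes of the processes in \<open>V\<close>: the map \<open>cls\<close>
  sends a process to its class, so that the identification is \<open>cls u = cls v\<close>. Which
  identification is used (modifications, almost everywhere on \<open>[0,T] \<times> \<Omega>\<close>, \<dots>) is left open; it
  only has to be compatible with the pointwise vector space operations. Processes are total
  functions of time, hence the requirement that \<open>cls\<close> ignores their values outside \<open>[0,T]\<close>.
\<close>

definition classes_of_processes ::
  "'a measure \<Rightarrow> real \<Rightarrow> (real \<Rightarrow> 'a \<Rightarrow> real) set \<Rightarrow> ((real \<Rightarrow> 'a \<Rightarrow> real) \<Rightarrow> 'h::real_vector) \<Rightarrow> bool"
where
  "classes_of_processes M T V cls \<longleftrightarrow>
     (\<forall>u\<in>V. \<forall>t\<in>{0..T}. u t \<in> borel_measurable M) \<and>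
     (\<lambda>t \<omega>. 0) \<in> V \<and>
     (\<forall>u\<in>V. \<forall>v\<in>V. (\<lambda>t \<omega>. u t \<omega> + v t \<omega>) \<in> V \<and>
        cls (\<lambda>t \<omega>. u t \<omega> + v t \<omega>) = cls u + cls v) \<and>
     (\<forall>c. \<forall>u\<in>V. (\<lambda>t \<omega>. c * u t \<omega>) \<in> V \<and> cls (\<lambda>t \<omega>. c * u t \<omega>) = c *\<^sub>R cls u) \<and>
     (\<forall>u\<in>V. \<forall>v\<in>V. (\<forall>t\<in>{0..T}. \<forall>\<omega>\<in>space M. u t \<omega> = v t \<omega>) \<longrightarrow> cls u = cls v) \<and>
     cls ` V = UNIV"

end

theory Submission
  imports Defs
begin

text \<open>
  Fix \<open>F\<close> in \<open>L\<^sup>2(\<Omega>)\<close>. The functional \<open>u \<mapsto> E[F \<delta>\<^sub>X(u)]\<close> is linear, since \<open>\<delta>\<^sub>X\<close> is linear up to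
  null sets and integrals ignore null sets. It is continuous at the origin, since by the
  Cauchy--Schwarz inequality its absolute value is at most \<open>\<parallel>F\<parallel> \<parallel>\<delta>\<^sub>X(u)\<parallel>\<close>, both norms being those of \<open>L\<^sup>2(\<Omega>)\<close>, and
  \<open>\<delta>\<^sub>X\<close> is continuous. So it is a bounded linear functional, and \<open>D\<^sub>XF\<close> is the vector that represents
  it in the Hilbert space \<open>\<H>\<^sub>X\<close> by the Riesz representation theorem.

  The Riesz theorem is proved variationally: the representing vector of \<open>f\<close> is the minimiser of
  \<open>J(x) = \<parallel>x\<parallel>\<^sup>2 - 2 f(x)\<close>. If \<open>f = \<langle>d, \<cdot>\<rangle>\<close>, then \<open>J(x) = \<parallel>x - d\<parallel>\<^sup>2 - \<parallel>d\<parallel>\<^sup>2\<close>, which explains the choice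
  of \<open>J\<close>. Minimising sequences are Cauchy by the parallelogram law, so completeness gives a
  minimiser, and the first variation of \<open>J\<close> there says exactly that it represents \<open>f\<close>.
\<close>

section \<open>The Riesz representation theorem\<close>

text \<open>
  Near \<open>t = 0\<close> a nonzero linear term dominates the quadratic one and takes both signs. This is the
  step from a minimum to a vanishing first variation.
\<close>

lemma linear_coefficient_eq_0_if_quadratic_nonneg:
  fixes b c :: real
  assumes nonneg: "\<And>t. 0 \<le> 2 * t * b + t\<^sup>2 * c" and "0 \<le> c"
  shows "b = 0"
proof (rule ccontr)
  assume "b \<noteq> 0"
  \<comment> \<open>This is the minimiser of the quadratic with \<open>c\<close> replaced by \<open>c + 1\<close>, which avoids a case
    distinction on \<open>c = 0\<close>.\<close>
  define t where "t = - b / (c + 1)"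
  have b: "b = - t * (c + 1)"
    using \<open>0 \<le> c\<close> by (simp add: t_def)
  with \<open>b \<noteq> 0\<close> have "t \<noteq> 0"
    by auto
  then have "0 < t\<^sup>2 * (c + 2)"
    using \<open>0 \<le> c\<close> by simp
  moreover have "2 * t * b + t\<^sup>2 * c = - (t\<^sup>2 * (c + 2))"
    by (simp add: b power2_eq_square algebra_simps)
  ultimately show False
    using nonneg[of t] by simp
qed

text \<open>
  The parallelogram law for \<open>x\<close> and \<open>y\<close>, in which the linear parts of \<open>J(x)\<close>, \<open>J(y)\<close> and \<open>J\<close> at the
  midpoint cancel: near-minimisers of \<open>J\<close> are close to each other.
\<close>

lemma dist_near_minimisers:
  fixes f :: "'h::real_inner \<Rightarrow> real"
  assumes "linear f"
    and lower: "\<And>z. m \<le> (norm z)\<^sup>2 - 2 * f z"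
    and x: "(norm x)\<^sup>2 - 2 * f x \<le> m + e"
    and y: "(norm y)\<^sup>2 - 2 * f y \<le> m + e"
  shows "(dist x y)\<^sup>2 \<le> 4 * e"
proof -
  have f: "f ((1/2) *\<^sub>R (x + y)) = (f x + f y) / 2"
    using \<open>linear f\<close> by (simp add: linear_add linear_scale)
  have "(norm (x - y))\<^sup>2 = 2 * (norm x)\<^sup>2 + 2 * (norm y)\<^sup>2 - 4 * (norm ((1/2) *\<^sub>R (x + y)))\<^sup>2"
    unfolding power2_norm_eq_inner
    by (simp add: inner_diff_left inner_diff_right inner_add_left inner_add_right inner_commute
        field_simps)
  then show ?thesis
    using lower[of "(1/2) *\<^sub>R (x + y)"] x y unfolding f dist_norm by argo
qed

theorem Riesz_representation:
  fixes f :: "'h::{real_inner, complete_space} \<Rightarrow> real"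
  assumes "bounded_linear f"
  shows "\<exists>!d. \<forall>u. f u = inner d u"
proof -
  interpret bounded_linear f by fact
  define J where "J x = (norm x)\<^sup>2 - 2 * f x" for x
  obtain K where K: "\<And>x. norm (f x) \<le> norm x * K"
    using bounded by blast
  have "- K\<^sup>2 \<le> J x" for x
  proof -
    have "2 * f x \<le> 2 * (norm x * K)"
      using K[of x] by simp
    moreover have "0 \<le> (norm x - K)\<^sup>2"
      by simp
    ultimately show ?thesis
      unfolding J_def by (simp add: power2_eq_square algebra_simps)
  qed
  then have bdd: "bdd_below (range J)"
    by (intro bdd_belowI[of _ "- K\<^sup>2"]) auto
  define m where "m = (INF x. J x)"
  have lower: "m \<le> J x" for x
    unfolding m_def using bdd by (intro cINF_lower) auto
  have "\<exists>x. J x < m + inverse (real (Suc n))" for n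
    using cINF_less_iff[OF _ bdd, of "m + inverse (real (Suc n))"] by (auto simp: m_def)
  then obtain X where X: "\<And>n. J (X n) < m + inverse (real (Suc n))"
    by metis
  have "Cauchy X"
  proof (rule metric_CauchyI)
    fix e :: real
    assume "0 < e"
    then have "0 < e\<^sup>2 / 4"
      by simp
    then obtain N where N: "inverse (real (Suc N)) < e\<^sup>2 / 4"
      using reals_Archimedean by blast
    have near: "J (X k) \<le> m + inverse (real (Suc N))" if "N \<le> k" for k
    proof -
      have "inverse (real (Suc k)) \<le> inverse (real (Suc N))"
        using that by (simp add: le_imp_inverse_le)
      then show ?thesis
        using X[of k] by linarith
    qed
    have "dist (X k) (X l) < e" if "N \<le> k" "N \<le> l" for k l
    proof -
      have "(dist (X k) (X l))\<^sup>2 \<le> 4 * inverse (real (Suc N))"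
        using near[OF that(1)] near[OF that(2)] lower
        by (intro dist_near_minimisers[OF linear_axioms, of m]) (auto simp: J_def)
      also have "\<dots> < e\<^sup>2"
        using N by simp
      finally show ?thesis
        using \<open>0 < e\<close> by (auto intro: power2_less_imp_less)
    qed
    then show "\<exists>N. \<forall>k\<ge>N. \<forall>l\<ge>N. dist (X k) (X l) < e"
      by blast
  qed
  then obtain d where d: "X \<longlonglongrightarrow> d"
    using Cauchy_convergent convergent_def by blast
  have "(\<lambda>n. J (X n)) \<longlonglongrightarrow> J d"
    unfolding J_def by (intro tendsto_intros d tendsto)
  moreover have "(\<lambda>n. m + inverse (real (Suc n))) \<longlonglongrightarrow> m"
    using tendsto_add[OF tendsto_const LIMSEQ_inverse_real_of_nat, of m] by simp
  ultimately have Jd: "J d \<le> m"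
    by (rule LIMSEQ_le) (use X less_imp_le in blast)
  have repr: "f u = inner d u" for u
  proof -
    have "0 \<le> 2 * t * (inner d u - f u) + t\<^sup>2 * (norm u)\<^sup>2" for t
    proof -
      have "J (d + t *\<^sub>R u) = J d + (2 * t * (inner d u - f u) + t\<^sup>2 * (norm u)\<^sup>2)"
        unfolding J_def power2_norm_eq_inner
        by (simp add: add scaleR inner_add_left inner_add_right inner_commute power2_eq_square
            algebra_simps)
      then show ?thesis
        using lower[of "d + t *\<^sub>R u"] Jd by linarith
    qed
    then have "inner d u - f u = 0"
      by (rule linear_coefficient_eq_0_if_quadratic_nonneg) simp
    then show ?thesis
      by simp
  qed
  show ?thesis
  proof (rule ex1I)
    show "\<forall>u. f u = inner d u"
      using repr by blast
  next
    fix d'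
    assume "\<forall>u. f u = inner d' u"
    then show "d' = d"
      using repr vector_eq_rdot by metis
  qed
qed

lemma bounded_linear_if_tendsto_0_at_0:
  fixes f :: "'v::real_normed_vector \<Rightarrow> 'w::real_normed_vector"
  assumes "linear f" and "(f \<longlongrightarrow> 0) (at 0)"
  shows "bounded_linear f"
proof -
  obtain r where "0 < r" and r: "\<And>x. x \<noteq> 0 \<Longrightarrow> dist x 0 < r \<Longrightarrow> dist (f x) 0 < 1"
    using tendstoD[OF assms(2), of 1] unfolding eventually_at by auto
  have "norm (f x) \<le> norm x * (2 / r)" for x
  proof (cases "x = 0")
    case True
    then show ?thesis
      using linear_0[OF \<open>linear f\<close>] by simp
  next
    case False
    \<comment> \<open>Rescale \<open>x\<close> to norm \<open>r / 2\<close>, strictly inside the ball on which \<open>f\<close> is controlled.\<close>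
    define c where "c = r / (2 * norm x)"
    have "0 < c"
      using False \<open>0 < r\<close> by (simp add: c_def)
    have "norm (c *\<^sub>R x) = r / 2"
      using False \<open>0 < r\<close> by (simp add: c_def)
    then have "norm (f (c *\<^sub>R x)) < 1"
      using r[of "c *\<^sub>R x"] False \<open>0 < c\<close> \<open>0 < r\<close> by simp
    then have "c * norm (f x) < 1"
      using \<open>0 < c\<close> by (simp add: linear_scale[OF \<open>linear f\<close>])
    then show ?thesis
      using False \<open>0 < r\<close> by (simp add: c_def field_simps)
  qed
  then show ?thesis
    using \<open>linear f\<close> by (intro bounded_linear.intro bounded_linear_axioms.intro exI allI)
qed

section \<open>Square-integrable random variables\<close>

text \<open>The inequality \<open>2 \<bar>f g\<bar> \<le> f\<^sup>2 + g\<^sup>2\<close> supplies the integrable majorant.\<close>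

lemma integrable_mult_square_integrable:
  assumes "square_integrable M f" and "square_integrable M g"
  shows "integrable M (\<lambda>x. f x * g x)"
proof (rule Bochner_Integration.integrable_bound)
  show "integrable M (\<lambda>x. (f x)\<^sup>2 + (g x)\<^sup>2)"
    using assms by (simp add: square_integrable_def)
  show "(\<lambda>x. f x * g x) \<in> borel_measurable M"
    using assms by (auto simp: square_integrable_def)
  have "\<bar>a * b\<bar> \<le> a\<^sup>2 + b\<^sup>2" for a b :: real
    using zero_le_power2[of "\<bar>a\<bar> - \<bar>b\<bar>"] zero_le_power2[of a] zero_le_power2[of b]
    unfolding power2_diff power2_abs abs_mult by linarith
  then show "AE x in M. norm (f x * g x) \<le> norm ((f x)\<^sup>2 + (g x)\<^sup>2)"
    by simp
qed

lemma Cauchy_Schwarz_L2_norm: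
  assumes f: "square_integrable M f" and g: "square_integrable M g"
  shows "\<bar>\<integral>x. f x * g x \<partial>M\<bar> \<le> L2_norm M f * L2_norm M g"
proof -
  note fg = integrable_mult_square_integrable[OF f g]
  have sq: "(\<integral>\<^sup>+x. ennreal ((h x)\<^sup>2) \<partial>M) = ennreal (\<integral>x. (h x)\<^sup>2 \<partial>M)"
    if "square_integrable M h" for h
    using that by (simp add: square_integrable_def nn_integral_eq_integral)
  have "(\<integral>\<^sup>+x. ennreal \<bar>f x\<bar> * ennreal \<bar>g x\<bar> \<partial>M) = ennreal (\<integral>x. \<bar>f x * g x\<bar> \<partial>M)"
    using nn_integral_eq_integral[OF integrable_abs[OF fg]] by (simp add: abs_mult ennreal_mult)
  then have "ennreal ((\<integral>x. \<bar>f x * g x\<bar> \<partial>M)\<^sup>2) \<le> ennreal ((\<integral>x. (f x)\<^sup>2 \<partial>M) * (\<integral>x. (g x)\<^sup>2 \<partial>M))"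
    using Cauchy_Schwarz_nn_integral[of "\<lambda>x. ennreal \<bar>f x\<bar>" M "\<lambda>x. ennreal \<bar>g x\<bar>"] f g
    by (auto simp: sq[OF f] sq[OF g] ennreal_power ennreal_mult square_integrable_def)
  then have "(\<integral>x. \<bar>f x * g x\<bar> \<partial>M)\<^sup>2 \<le> (\<integral>x. (f x)\<^sup>2 \<partial>M) * (\<integral>x. (g x)\<^sup>2 \<partial>M)"
    by (simp add: ennreal_le_iff)
  then have "(\<integral>x. \<bar>f x * g x\<bar> \<partial>M) \<le> L2_norm M f * L2_norm M g"
    unfolding L2_norm_def by (metis real_le_rsqrt real_sqrt_mult)
  then show ?thesis
    using integral_abs_bound[of M "\<lambda>x. f x * g x"] by linarith
qed

lemma linear_integral_mult_L2_linear:
  assumes F: "square_integrable M F" and \<delta>: "L2_linear M \<delta>"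
  shows "linear (\<lambda>u. \<integral>\<omega>. F \<omega> * \<delta> u \<omega> \<partial>M)"
proof -
  have sq: "square_integrable M (\<delta> u)" for u
    using \<delta> by (simp add: L2_linear_def)
  note [simp] = integrable_mult_square_integrable[OF F sq]
  have [measurable]: "F \<in> borel_measurable M" "\<delta> u \<in> borel_measurable M" for u
    using F sq[of u] by (simp_all add: square_integrable_def)
  show ?thesis
  proof (rule linearI)
    fix u v
    have "AE \<omega> in M. \<delta> (u + v) \<omega> = \<delta> u \<omega> + \<delta> v \<omega>"
      using \<delta> by (simp add: L2_linear_def)
    then have "(\<integral>\<omega>. F \<omega> * \<delta> (u + v) \<omega> \<partial>M) = (\<integral>\<omega>. F \<omega> * \<delta> u \<omega> + F \<omega> * \<delta> v \<omega> \<partial>M)"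
      by (intro integral_cong_AE) (auto simp: algebra_simps)
    then show "(\<integral>\<omega>. F \<omega> * \<delta> (u + v) \<omega> \<partial>M) = (\<integral>\<omega>. F \<omega> * \<delta> u \<omega> \<partial>M) + (\<integral>\<omega>. F \<omega> * \<delta> v \<omega> \<partial>M)"
      by simp
  next
    fix c u
    have "AE \<omega> in M. \<delta> (c *\<^sub>R u) \<omega> = c * \<delta> u \<omega>"
      using \<delta> by (simp add: L2_linear_def)
    then have "(\<integral>\<omega>. F \<omega> * \<delta> (c *\<^sub>R u) \<omega> \<partial>M) = (\<integral>\<omega>. c * (F \<omega> * \<delta> u \<omega>) \<partial>M)"
      by (intro integral_cong_AE) auto
    then show "(\<integral>\<omega>. F \<omega> * \<delta> (c *\<^sub>R u) \<omega> \<partial>M) = c *\<^sub>R (\<integral>\<omega>. F \<omega> * \<delta> u \<omega> \<partial>M)"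
      by simp
  qed
qed

lemma L2_norm_tendsto_0_at_0:
  assumes \<delta>: "L2_linear M \<delta>" and cont: "L2_continuous M \<delta>"
  shows "((\<lambda>u. L2_norm M (\<delta> u)) \<longlongrightarrow> 0) (at 0)"
proof -
  have [measurable]: "\<delta> u \<in> borel_measurable M" for u
    using \<delta> by (simp add: L2_linear_def square_integrable_def)
  \<comment> \<open>The representative \<open>\<delta> 0\<close> vanishes only almost everywhere.\<close>
  have "AE \<omega> in M. \<delta> (0 *\<^sub>R 0) \<omega> = 0 * \<delta> 0 \<omega>"
    using \<delta> unfolding L2_linear_def by blast
  then have "L2_norm M (\<lambda>\<omega>. \<delta> u \<omega> - \<delta> 0 \<omega>) = L2_norm M (\<delta> u)" for u
    unfolding L2_norm_def by (intro arg_cong[of _ _ sqrt] integral_cong_AE) auto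
  moreover have "((\<lambda>u. L2_norm M (\<lambda>\<omega>. \<delta> u \<omega> - \<delta> 0 \<omega>)) \<longlongrightarrow> 0) (at 0)"
    using cont by (simp add: L2_continuous_def)
  ultimately show ?thesis
    by simp
qed

section \<open>The operator-covariant derivative\<close>

theorem proposition3p10:
  fixes M :: "'a measure"
    and T :: real
    and X :: "real \<Rightarrow> 'a \<Rightarrow> real"
    and V :: "(real \<Rightarrow> 'a \<Rightarrow> real) set"
    and cls :: "(real \<Rightarrow> 'a \<Rightarrow> real) \<Rightarrow> 'h::{real_inner, complete_space}"
    and \<delta>\<^sub>X :: "'h \<Rightarrow> 'a \<Rightarrow> real"
  assumes "prob_space M" and "complete_measure M"
    and "0 \<le> T"
    and "square_integrable_process M T X"
    and "separable_space (euclidean :: 'h topology)"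
    and "classes_of_processes M T V cls"
    and "L2_linear M \<delta>\<^sub>X"
    and "L2_continuous M \<delta>\<^sub>X"
  shows "\<forall>F. square_integrable M F \<longrightarrow>
           (\<exists>!D\<^sub>XF :: 'h. \<forall>u. (\<integral>\<omega>. F \<omega> * \<delta>\<^sub>X u \<omega> \<partial>M) = inner D\<^sub>XF u)"
proof (intro allI impI)
  fix F
  assume F: "square_integrable M F"
  have bound: "norm (\<integral>\<omega>. F \<omega> * \<delta>\<^sub>X u \<omega> \<partial>M) \<le> L2_norm M F * L2_norm M (\<delta>\<^sub>X u)" for u
    using Cauchy_Schwarz_L2_norm[OF F] \<open>L2_linear M \<delta>\<^sub>X\<close> by (simp add: L2_linear_def)
  have "((\<lambda>u. L2_norm M F * L2_norm M (\<delta>\<^sub>X u)) \<longlongrightarrow> 0) (at 0)"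
    using L2_norm_tendsto_0_at_0[OF \<open>L2_linear M \<delta>\<^sub>X\<close> \<open>L2_continuous M \<delta>\<^sub>X\<close>]
    by (rule tendsto_mult_right_zero)
  then have "((\<lambda>u. \<integral>\<omega>. F \<omega> * \<delta>\<^sub>X u \<omega> \<partial>M) \<longlongrightarrow> 0) (at 0)"
    by (rule Lim_null_comparison[OF always_eventually, rotated]) (use bound in blast)
  then have "bounded_linear (\<lambda>u. \<integral>\<omega>. F \<omega> * \<delta>\<^sub>X u \<omega> \<partial>M)"
    using linear_integral_mult_L2_linear[OF F \<open>L2_linear M \<delta>\<^sub>X\<close>]
    by (intro bounded_linear_if_tendsto_0_at_0)
  then show "\<exists>!D\<^sub>XF. \<forall>u. (\<integral>\<omega>. F \<omega> * \<delta>\<^sub>X u \<omega> \<partial>M) = inner D\<^sub>XF u"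
    by (rule Riesz_representation)
qed

end
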